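(* Let $q$ be an odd prime power, $\mathbb{F}_q$ the field with $q$ elements, $d\ge1$. Let $h(\mathbf{x})\in\mathbb{F}_q[x_1,\ldots,x_d]$ be a fixed polynomial of degree at most $q-1$ and $b_1,\ldots,b_d$ fixed positive integers with $\gcd(b_j,q-1)=1$ for all $j$. For $\mathbf{a}=(a_1,\ldots,a_{d+1})\in\mathbb{F}_q^{d+1}$ let $$W_{\mathbf{a}}=\{\mathbf{x}\in\mathbb{F}_q^d: h(\mathbf{x})+a_1x_1^{b_1}+\cdots+a_dx_d^{b_d}+a_{d+1}=0\}.$$ Let $\mathcal{P}$ be a set of points in $\mathbb{F}_q^d$ and $\mathcal{S}$ a set of hypersurfaces of the form $W_{\mathbf{a}}$. Then the number of incidences $I(\mathcal{P},\mathcal{S})=|\{(p,s)\in\mathcal{P}\times\mathcal{S}:p\in s\}|$ satisfies $$\left|I(\mathcal{P},\mathcal{S})-\frac{|\mathcal{P}||\mathcal{S}|}{q}\right|\le q^{d/2}\sqrt{|\mathcal{P}||\mathcal{S}|}.$$ *)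

theory Defs
  imports
    "HOL-Analysis.Finite_Cartesian_Product"
    "HOL-Library.Poly_Mapping"
    "HOL-Number_Theory.Prime_Powers"
begin

text \<open>
  Polynomials in the variables \<open>'v\<close> over \<open>'a\<close>: finitely supported coefficient functions on
  exponent vectors.
\<close>

type_synonym ('v, 'a) mpoly = "('v \<Rightarrow>\<^sub>0 nat) \<Rightarrow>\<^sub>0 'a"

definition monom_degree :: "('v \<Rightarrow>\<^sub>0 nat) \<Rightarrow> nat" where
  "monom_degree m = (\<Sum>j\<in>Poly_Mapping.keys m. Poly_Mapping.lookup m j)"

text \<open>The zero polynomial is given degree 0.\<close>

definition total_degree :: "('v, 'a::zero) mpoly \<Rightarrow> nat" where
  "total_degree h = Max (insert 0 (monom_degree ` Poly_Mapping.keys h))"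

definition mpoly_eval :: "('v::finite, 'a::comm_semiring_1) mpoly \<Rightarrow> 'a ^ 'v \<Rightarrow> 'a" where
  "mpoly_eval h x =
     (\<Sum>m\<in>Poly_Mapping.keys h.
        Poly_Mapping.lookup h m * (\<Prod>j\<in>UNIV. (x $ j) ^ Poly_Mapping.lookup m j))"

text \<open>
  With \<open>d = CARD('d)\<close>, a parameter vector \<open>a\<close> with \<open>d + 1\<close> entries is indexed by
  \<open>'d option\<close>: the entry \<open>a $ Some j\<close> is the coefficient of \<open>x\<^sub>j ^ b\<^sub>j\<close>, and \<open>a $ None\<close> is the
  last entry, the constant term.
\<close>

definition hypersurface ::
  "('d::finite, 'k::field) mpoly \<Rightarrow> ('d \<Rightarrow> nat) \<Rightarrow> 'k ^ ('d option) \<Rightarrow> ('k ^ 'd) set" where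
  "hypersurface h b a =
     {x. mpoly_eval h x + (\<Sum>j\<in>UNIV. a $ Some j * (x $ j) ^ b j) + a $ None = 0}"

definition incidences :: "'p set \<Rightarrow> 'p set set \<Rightarrow> nat" where
  "incidences P S = card {(p, s). p \<in> P \<and> s \<in> S \<and> p \<in> s}"

end

theory Submission
  imports Defs "HOL-Analysis.Convex"
begin

text \<open>
  For a point \<open>p\<close> let \<open>f\<^sub>p(a) = [p \<in> W\<^sub>a] - 1/q\<close>, a function of the parameter vector
  \<open>a \<in> F\<^sub>q\<^bsup>d+1\<^esup>\<close>. Since \<open>gcd(b\<^sub>j, q - 1) = 1\<close>, the map \<open>x \<mapsto> (x\<^sub>j ^ b\<^sub>j)\<^sub>j\<close> is injective, so
  the affine forms in \<open>a\<close> that cut out \<open>p \<in> W\<^sub>a\<close> and \<open>p' \<in> W\<^sub>a\<close> have non-proportional linear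
  parts for \<open>p \<noteq> p'\<close>; hence the \<open>f\<^sub>p\<close> are pairwise orthogonal, with squared norm at most
  \<open>q\<^sup>d\<close>. The discrepancy of the incidence count is the sum of \<open>f\<^sub>p(a)\<close> over \<open>p \<in> P\<close> and one
  parameter \<open>a\<close> for each hypersurface, and Cauchy--Schwarz bounds it.
\<close>

text \<open>Multiplication by \<open>x\<close> permutes the nonzero elements, so their product
  absorbs one factor \<open>x\<close> for each of them; cancel it.\<close>

lemma finite_field_power_card_minus_one:
  fixes x :: "'k::{field, finite}"
  assumes "x \<noteq> 0"
  shows "x ^ (CARD('k) - 1) = 1"
proof -
  have "(\<Prod>y\<in>UNIV - {0}. x * y) = \<Prod>(UNIV - {0})"
    by (rule prod.reindex_bij_witness[of _ "\<lambda>y. y / x" "\<lambda>y. x * y"]) (use assms in auto)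
  then have "x ^ card (UNIV - {0::'k}) * \<Prod>(UNIV - {0}) = \<Prod>(UNIV - {0})"
    by (simp add: prod.distrib)
  then show ?thesis
    by (simp add: card_Diff_singleton)
qed

text \<open>By Bezout some \<open>u\<close> satisfies \<open>n * u\<close> = 1 modulo
  \<open>CARD('k) - 1\<close>, so raising to the power \<open>u\<close> undoes the power
  \<open>n\<close> on nonzero elements. This is applied to the quotient
  \<open>x / y\<close>.\<close>

lemma inj_power_coprime_card:
  fixes n :: nat
  assumes "n > 0" and "gcd n (CARD('k) - 1) = 1"
  shows "inj (\<lambda>x::'k::{field, finite}. x ^ n)"
proof (rule injI)
  fix x y :: 'k
  assume eq: "x ^ n = y ^ n"
  show "x = y"
  proof (cases "y = 0")
    case True
    with eq \<open>n > 0\<close> show ?thesis by (simp add: power_0_left)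
  next
    case False
    with eq \<open>n > 0\<close> have "x \<noteq> 0" by (auto simp: power_0_left)
    define z where "z = x / y"
    have "z \<noteq> 0" using \<open>x \<noteq> 0\<close> False by (simp add: z_def)
    have zn: "z ^ n = 1" using eq False by (simp add: z_def power_divide)
    obtain u v where uv: "n * u = (CARD('k) - 1) * v + 1"
      using bezout_nat[of n "CARD('k) - 1"] assms by auto
    have "z ^ (n * u) = 1" by (simp add: power_mult zn)
    moreover have "z ^ ((CARD('k) - 1) * v + 1) = z"
      using finite_field_power_card_minus_one[OF \<open>z \<noteq> 0\<close>] by (simp add: power_add power_mult)
    ultimately have "z = 1" using uv by metis
    then show ?thesis using False by (simp add: z_def)
  qed
qed

text \<open>Each shift by \<open>w t\<close> preserves the sum over all \<open>a\<close>. Averaging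
  over \<open>t\<close> then pulls out \<open>F\<close>, which the shifts fix, and leaves sums of
  \<open>H\<close> that cancel.\<close>

lemma sum_mult_eq_0_if_translates_cancel:
  fixes F H :: "'a::{finite, ab_group_add} \<Rightarrow> real" and w :: "'t::finite \<Rightarrow> 'a"
  assumes "\<And>a t. F (a + w t) = F a" and "\<And>a. (\<Sum>t\<in>UNIV. H (a + w t)) = 0"
  shows "(\<Sum>a\<in>UNIV. F a * H a) = 0"
proof -
  have "(\<Sum>a\<in>UNIV. F a * H a) = (\<Sum>a\<in>UNIV. F (a + w t) * H (a + w t))" for t
    by (rule sum.reindex_bij_witness[of _ "\<lambda>a. a + w t" "\<lambda>a. a - w t"]) auto
  then have "real CARD('t) * (\<Sum>a\<in>UNIV. F a * H a)
      = (\<Sum>t\<in>UNIV. \<Sum>a\<in>UNIV. F (a + w t) * H (a + w t))"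
    by simp
  also have "\<dots> = (\<Sum>a\<in>UNIV. F a * (\<Sum>t\<in>UNIV. H (a + w t)))"
    by (subst sum.swap) (simp add: assms(1) sum_distrib_left)
  finally show ?thesis
    by (simp add: assms(2))
qed

definition surface_value ::
  "('d::finite, 'k::field) mpoly \<Rightarrow> ('d \<Rightarrow> nat) \<Rightarrow> 'k ^ 'd \<Rightarrow> 'k ^ ('d option) \<Rightarrow> 'k" where
  "surface_value h b x a = mpoly_eval h x + (\<Sum>j\<in>UNIV. a $ Some j * (x $ j) ^ b j) + a $ None"

definition balanced_indicator ::
  "('d::finite, 'k::{field, finite}) mpoly \<Rightarrow> ('d \<Rightarrow> nat) \<Rightarrow> 'k ^ 'd \<Rightarrow> 'k ^ ('d option) \<Rightarrow> real"
  where "balanced_indicator h b x a = of_bool (x \<in> hypersurface h b a) - 1 / real CARD('k)"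

lemma balanced_indicator_eq:
  fixes h :: "('d::finite, 'k::{field, finite}) mpoly"
  shows "balanced_indicator h b x a = of_bool (surface_value h b x a = 0) - 1 / real CARD('k)"
  by (simp add: balanced_indicator_def hypersurface_def surface_value_def)

lemma surface_value_add_const:
  "surface_value h b x (a + axis None t) = surface_value h b x a + t"
  by (simp add: surface_value_def axis_def algebra_simps)

lemma surface_value_add_axis:
  "surface_value h b x (a + axis (Some j) t) = surface_value h b x a + t * (x $ j) ^ b j"
proof -
  have "(\<Sum>i\<in>UNIV. (if i = j then t else 0) * (x $ i) ^ b i) = t * (x $ j) ^ b j"
    by (simp add: if_distrib[of "\<lambda>c. c * _"] cong: if_cong)
  then show ?thesis
    by (simp add: surface_value_def axis_def distrib_right sum.distrib algebra_simps)
qed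

text \<open>Exactly one \<open>t\<close> is a root, and its contribution 1 balances the
  \<open>CARD('k)\<close> copies of \<open>1 / CARD('k)\<close>.\<close>

lemma sum_balanced_root:
  fixes c v :: "'k::{field, finite}"
  assumes "c \<noteq> 0"
  shows "(\<Sum>t\<in>UNIV. of_bool (v + t * c = 0) - 1 / real CARD('k)) = 0"
proof -
  have "v + t * c = 0 \<longleftrightarrow> t = - v / c" for t
    using assms by (auto simp: field_simps eq_neg_iff_add_eq_0)
  then show ?thesis
    by (simp add: sum_subtractf of_bool_def)
qed

lemma sum_balanced_indicator:
  fixes h :: "('d::finite, 'k::{field, finite}) mpoly"
  shows "(\<Sum>a\<in>UNIV. balanced_indicator h b x a) = 0"
  \<comment> \<open>Shifting only the constant term moves the value through the whole field.\<close>
  using sum_mult_eq_0_if_translates_cancel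
      [of "\<lambda>_. 1" "axis None :: 'k \<Rightarrow> 'k ^ ('d option)" "balanced_indicator h b x"]
    sum_balanced_root[of "1::'k"]
  by (simp add: balanced_indicator_eq surface_value_add_const)

lemma sum_balanced_indicator_mult:
  fixes h :: "('d::finite, 'k::{field, finite}) mpoly"
  assumes "(x $ j) ^ b j \<noteq> (y $ j) ^ b j"
  shows "(\<Sum>a\<in>UNIV. balanced_indicator h b x a * balanced_indicator h b y a) = 0"
proof -
  \<comment> \<open>Translating along this direction fixes the form of \<open>x\<close> and moves that of \<open>y\<close>.\<close>
  define w :: "'k \<Rightarrow> 'k ^ ('d option)"
    where "w t = axis (Some j) t + axis None (- (t * (x $ j) ^ b j))" for t
  have w: "surface_value h b z (a + w t)
      = surface_value h b z a + t * ((z $ j) ^ b j - (x $ j) ^ b j)" for z a t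
    unfolding w_def add.assoc[symmetric] surface_value_add_const surface_value_add_axis
    by (simp add: algebra_simps)
  show ?thesis
    by (rule sum_mult_eq_0_if_translates_cancel[where w = w])
      (use assms sum_balanced_root[of "(y $ j) ^ b j - (x $ j) ^ b j"] in
        \<open>simp_all add: balanced_indicator_eq w\<close>)
qed

lemma sum_balanced_indicator_square_le:
  fixes h :: "('d::finite, 'k::{field, finite}) mpoly"
  shows "(\<Sum>a\<in>UNIV. (balanced_indicator h b x a)\<^sup>2) \<le> real CARD('k) ^ CARD('d)"
proof -
  define q where "q = real CARD('k)"
  have q: "q > 0" by (simp add: q_def)
  \<comment> \<open>An indicator equals its own square, so the square is affine in the balanced
    indicator, and its linear part sums to 0.\<close>
  have "(balanced_indicator h b x a)\<^sup>2
      = (1 - 2 / q) * balanced_indicator h b x a + (1 / q) * (1 - 1 / q)" for a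
    by (cases "x \<in> hypersurface h b a")
      (use q in \<open>simp_all add: balanced_indicator_def q_def[symmetric] power2_eq_square field_simps\<close>)
  \<comment> \<open>The power \<open>CARD('d) + 1\<close> of \<open>q\<close> counts the parameter
    vectors.\<close>
  then have "(\<Sum>a\<in>UNIV. (balanced_indicator h b x a)\<^sup>2)
      = q ^ (CARD('d) + 1) * ((1 / q) * (1 - 1 / q))"
    by (simp add: sum.distrib sum_distrib_left[symmetric] sum_balanced_indicator q_def
        card_UNIV_option)
  also have "\<dots> = q ^ CARD('d) * (1 - 1 / q)"
    using q by simp
  also have "\<dots> \<le> q ^ CARD('d) * 1"
    using q by (intro mult_left_mono) auto
  finally show ?thesis by (simp add: q_def)
qed

text \<open>Expanding the square leaves only the diagonal terms: distinct points differ in some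
  coordinate, hence in its power, which gives orthogonality.\<close>

lemma sum_square_sum_balanced_indicator_le:
  fixes h :: "('d::finite, 'k::{field, finite}) mpoly"
  assumes "\<And>j. b j > 0" and "\<And>j. gcd (b j) (CARD('k) - 1) = 1"
  shows "(\<Sum>a\<in>UNIV. (\<Sum>p\<in>P. balanced_indicator h b p a)\<^sup>2)
           \<le> real (card P) * real CARD('k) ^ CARD('d)"
proof -
  let ?f = "balanced_indicator h b"
  have orth: "(\<Sum>a\<in>UNIV. ?f p a * ?f r a) = 0" if neq: "p \<noteq> r" for p r
  proof -
    obtain j where "p $ j \<noteq> r $ j" using neq by (auto simp: vec_eq_iff)
    then have "(p $ j) ^ b j \<noteq> (r $ j) ^ b j"
      using injD[OF inj_power_coprime_card[OF assms]] by blast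
    then show ?thesis by (rule sum_balanced_indicator_mult)
  qed
  have "(\<Sum>a\<in>UNIV. (\<Sum>p\<in>P. ?f p a)\<^sup>2) = (\<Sum>a\<in>UNIV. \<Sum>p\<in>P. \<Sum>r\<in>P. ?f p a * ?f r a)"
    by (simp add: power2_eq_square sum_product)
  also have "\<dots> = (\<Sum>p\<in>P. \<Sum>a\<in>UNIV. \<Sum>r\<in>P. ?f p a * ?f r a)"
    by (rule sum.swap)
  also have "\<dots> = (\<Sum>p\<in>P. \<Sum>r\<in>P. \<Sum>a\<in>UNIV. ?f p a * ?f r a)"
    by (intro sum.cong refl sum.swap)
  also have "\<dots> = (\<Sum>p\<in>P. \<Sum>r\<in>P. if r = p then \<Sum>a\<in>UNIV. (?f p a)\<^sup>2 else 0)"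
    by (intro sum.cong refl) (auto simp: orth power2_eq_square)
  also have "\<dots> = (\<Sum>p\<in>P. \<Sum>a\<in>UNIV. (?f p a)\<^sup>2)"
    by simp
  also have "\<dots> \<le> (\<Sum>p\<in>P. real CARD('k) ^ CARD('d))"
    by (intro sum_mono sum_balanced_indicator_square_le)
  finally show ?thesis by simp
qed

lemma incidences_eq_sum:
  assumes "finite P" and "finite S"
  shows "real (incidences P S) = (\<Sum>s\<in>S. \<Sum>p\<in>P. of_bool (p \<in> s))"
proof -
  have "{(p, s). p \<in> P \<and> s \<in> S \<and> p \<in> s} = (SIGMA p:P. {s\<in>S. p \<in> s})"
    by auto
  then have "real (incidences P S) = (\<Sum>p\<in>P. \<Sum>s\<in>S. of_bool (p \<in> s))"
    using assms by (simp add: incidences_def Int_def)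
  then show ?thesis by (simp add: sum.swap[of _ S])
qed

theorem theorem1p6:
  fixes q d :: nat
    and h :: "('d::finite, 'k::{field, finite}) mpoly"
    and b :: "'d \<Rightarrow> nat"
    and P :: "('k ^ 'd) set"
    and S :: "('k ^ 'd) set set"
  assumes "primepow q" and "odd q"
    and "CARD('k) = q"
    and "CARD('d) = d"
    and "total_degree h \<le> q - 1"
    and "\<And>j. b j > 0"
    and "\<And>j. gcd (b j) (q - 1) = 1"
    and "S \<subseteq> range (hypersurface h b)"
  shows "\<bar>real (incidences P S) - real (card P) * real (card S) / real q\<bar>
           \<le> real q powr (real d / 2) * sqrt (real (card P) * real (card S))"
proof -
  let ?f = "balanced_indicator h b"
  \<comment> \<open>Different parameters can define the same point set (for \<open>h = 0\<close>,
    any nonzero multiple of \<open>a\<close> does), so one is chosen for each member of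
    \<open>S\<close>.\<close>
  obtain A where inj: "inj_on (hypersurface h b) A" and S: "S = hypersurface h b ` A"
    using assms(8) by (auto simp: subset_image_inj)
  have q: "real q > 0" using assms(2) by (auto intro: Nat.gr0I)
  have card: "card S = card A" by (simp add: S card_image inj)
  have "real (incidences P S) = (\<Sum>a\<in>A. \<Sum>p\<in>P. of_bool (p \<in> hypersurface h b a))"
    by (simp add: incidences_eq_sum S sum.reindex[OF inj])
  then have diff: "real (incidences P S) - real (card P) * real (card S) / real q
      = (\<Sum>a\<in>A. \<Sum>p\<in>P. ?f p a)"
    by (simp add: balanced_indicator_def sum_subtractf card assms(3))
  have "(\<Sum>a\<in>A. \<Sum>p\<in>P. ?f p a)\<^sup>2 \<le> real (card A) * (\<Sum>a\<in>A. (\<Sum>p\<in>P. ?f p a)\<^sup>2)"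
    using Cauchy_Schwarz_ineq_sum[of "\<lambda>_. 1" "\<lambda>a. \<Sum>p\<in>P. ?f p a" A] by simp
  \<comment> \<open>Passing to all parameters only adds squares and makes orthogonality
    available.\<close>
  also have "(\<Sum>a\<in>A. (\<Sum>p\<in>P. ?f p a)\<^sup>2) \<le> (\<Sum>a\<in>UNIV. (\<Sum>p\<in>P. ?f p a)\<^sup>2)"
    by (intro sum_mono2) auto
  also have "\<dots> \<le> real (card P) * real q ^ d"
    using sum_square_sum_balanced_indicator_le[of b h P] assms by simp
  finally have "(\<Sum>a\<in>A. \<Sum>p\<in>P. ?f p a)\<^sup>2 \<le> real q ^ d * (real (card P) * real (card S))"
    by (simp add: card mult_right_mono mult_ac)
  then have "\<bar>\<Sum>a\<in>A. \<Sum>p\<in>P. ?f p a\<bar> \<le> sqrt (real q ^ d * (real (card P) * real (card S)))"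
    by (rule real_le_rsqrt[of "\<bar>_\<bar>", simplified])
  also have "\<dots> = real q powr (real d / 2) * sqrt (real (card P) * real (card S))"
    using q by (simp add: real_sqrt_mult powr_half_sqrt[symmetric] powr_powr powr_realpow[symmetric])
  finally show ?thesis unfolding diff .
qed

end
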